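(* Every finite group $G$ of nilpotency class $2$ is rational; that is, for every word $w$ (in any number of variables), every $g\in G$ and every integer $e$ relatively prime to $|G|$, one has $N_{w}(g)=N_{w}(g^e)$.
   Context: A word $w$ in $k$ variables $x_1,\ldots,x_k$ is an element of the free group $F_k$ on $x_1,\ldots,x_k$. For elements $g_1,\ldots,g_k$ of a group $G$, $w(g_1,\ldots,g_k)\in G$ denotes the image of $w$ under the homomorphism $F_k\to G$ sending $x_i\mapsto g_i$ for $1\le i\le k$. For a finite group $G$ and $g\in G$, $N_w(g)=N_{w,G}(g)$ is the number of $k$-tuples $(g_1,\ldots,g_k)\in G^{k}$ with $w(g_1,\ldots,g_k)=g$. A pair $(G,w)$ is called rational if $N_w(g)=N_w(g^e)$ for all $g\in G$ and every integer $e$ relatively prime to $|G|$; the group $G$ is called rational if $(G,w)$ is rational for all words $w$. *)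

theory Defs
  imports "HOL-Algebra.Algebra"
begin

section \<open>Free groups\<close>

text \<open>
  The free group on the set \<open>I\<close> is realised by reduced words: \<open>(i, True)\<close> stands for
  \<open>x\<^sub>i\<close> and \<open>(i, False)\<close> for the inverse of \<open>x\<^sub>i\<close>.
\<close>

type_synonym 'i letter = "'i \<times> bool"

definition letter_inv :: "'i letter \<Rightarrow> 'i letter" where
  "letter_inv a = (fst a, \<not> snd a)"

definition reduced :: "'i letter list \<Rightarrow> bool" where
  "reduced w \<longleftrightarrow> successively (\<lambda>a b. b \<noteq> letter_inv a) w"

fun cons_cancel :: "'i letter \<Rightarrow> 'i letter list \<Rightarrow> 'i letter list" where
  "cons_cancel a [] = [a]"
| "cons_cancel a (b # w) = (if b = letter_inv a then w else a # b # w)"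

definition free_group :: "'i set \<Rightarrow> 'i letter list monoid" where
  "free_group I =
     \<lparr>carrier = {w. reduced w \<and> fst ` set w \<subseteq> I},
      monoid.mult = (\<lambda>u v. foldr cons_cancel u v),
      one = []\<rparr>"

definition free_gen :: "'i \<Rightarrow> 'i letter list" where
  "free_gen i = [(i, True)]"

lemma letter_inv_letter_inv [simp]: "letter_inv (letter_inv a) = a"
  by (simp add: letter_inv_def)

lemma letter_inv_neq [simp]: "letter_inv a \<noteq> a" "a \<noteq> letter_inv a"
  by (auto simp: letter_inv_def prod_eq_iff)

lemma fst_letter_inv [simp]: "fst (letter_inv a) = fst a"
  by (simp add: letter_inv_def)

lemma reduced_Nil [simp]: "reduced []"
  by (simp add: reduced_def)

lemma reduced_single [simp]: "reduced [a]"
  by (simp add: reduced_def)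

lemma reduced_Cons: "reduced (a # w) \<longleftrightarrow> reduced w \<and> (w = [] \<or> hd w \<noteq> letter_inv a)"
  by (auto simp: reduced_def successively_Cons)

lemma reduced_cons_cancel: "reduced w \<Longrightarrow> reduced (cons_cancel a w)"
  by (cases w) (auto simp: reduced_Cons)

lemma reduced_foldr: "reduced v \<Longrightarrow> reduced (foldr cons_cancel u v)"
  by (induction u) (auto simp: reduced_cons_cancel)

lemma set_cons_cancel: "set (cons_cancel a w) \<subseteq> insert a (set w)"
  by (cases w) auto

lemma set_foldr_cons_cancel: "set (foldr cons_cancel u v) \<subseteq> set u \<union> set v"
proof (induction u)
  case (Cons a u)
  then show ?case using set_cons_cancel[of a "foldr cons_cancel u v"] by auto
qed auto

lemma cons_cancel_inv: "reduced w \<Longrightarrow> cons_cancel a (cons_cancel (letter_inv a) w) = w"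
  by (cases w rule: list.exhaust; cases "tl w") (auto simp: reduced_Cons)

lemma foldr_cons_cancel_cons_cancel:
  assumes "reduced v" "reduced w"
  shows "foldr cons_cancel (cons_cancel a v) w = cons_cancel a (foldr cons_cancel v w)"
  using assms by (cases v) (auto simp: cons_cancel_inv reduced_foldr)

lemma foldr_cons_cancel_assoc:
  assumes "reduced v" "reduced w"
  shows "foldr cons_cancel (foldr cons_cancel u v) w = foldr cons_cancel u (foldr cons_cancel v w)"
  using assms by (induction u) (auto simp: foldr_cons_cancel_cons_cancel reduced_foldr)

lemma foldr_cons_cancel_reduced: "reduced u \<Longrightarrow> foldr cons_cancel u [] = u"
proof (induction u)
  case (Cons a u)
  then show ?case by (cases u) (auto simp: reduced_Cons)
qed auto

lemma reduced_rev_inv: "reduced w \<Longrightarrow> reduced (rev (map letter_inv w))"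
  unfolding reduced_def successively_rev successively_map
  by (erule successively_mono) auto

lemma foldr_cons_cancel_rev_inv:
  "reduced v \<Longrightarrow> foldr cons_cancel (rev (map letter_inv u)) (foldr cons_cancel u v) = v"
proof (induction u arbitrary: v)
  case (Cons a u)
  have "cons_cancel (letter_inv a) (cons_cancel a (foldr cons_cancel u v)) = foldr cons_cancel u v"
    using cons_cancel_inv[of "foldr cons_cancel u v" "letter_inv a"] Cons.prems
    by (simp add: reduced_foldr)
  then show ?case using Cons by simp
qed auto

theorem group_free_group: "group (free_group I)"
proof (rule groupI)
  fix u v assume "u \<in> carrier (free_group I)" "v \<in> carrier (free_group I)"
  then show "u \<otimes>\<^bsub>free_group I\<^esub> v \<in> carrier (free_group I)"
    using set_foldr_cons_cancel[of u v] by (fastforce simp: free_group_def reduced_foldr)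
next
  fix u assume u: "u \<in> carrier (free_group I)"
  then have "rev (map letter_inv u) \<in> carrier (free_group I)"
    by (auto simp: free_group_def reduced_rev_inv)
  moreover have "rev (map letter_inv u) \<otimes>\<^bsub>free_group I\<^esub> u = \<one>\<^bsub>free_group I\<^esub>"
    using foldr_cons_cancel_rev_inv[of "[]" u] u
    by (simp add: free_group_def foldr_cons_cancel_reduced)
  ultimately show "\<exists>y\<in>carrier (free_group I). y \<otimes>\<^bsub>free_group I\<^esub> u = \<one>\<^bsub>free_group I\<^esub>"
    by blast
qed (auto simp: free_group_def foldr_cons_cancel_assoc)

lemma free_gen_closed: "i \<in> I \<Longrightarrow> free_gen i \<in> carrier (free_group I)"
  by (simp add: free_group_def free_gen_def)


section \<open>Word maps\<close>

definition free_hom ::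
  "('a, 'b) monoid_scheme \<Rightarrow> 'i set \<Rightarrow> ('i \<Rightarrow> 'a) \<Rightarrow> 'i letter list \<Rightarrow> 'a" where
  "free_hom G I g = (THE h. h \<in> hom (free_group I) G \<and> h \<in> extensional (carrier (free_group I))
                         \<and> (\<forall>i\<in>I. h (free_gen i) = g i))"

text \<open>
  The following shows that the description in \<open>free_hom_def\<close> determines a unique function, and
  gives its value explicitly.
\<close>

fun letter_value :: "('a, 'b) monoid_scheme \<Rightarrow> ('i \<Rightarrow> 'a) \<Rightarrow> 'i letter \<Rightarrow> 'a" where
  "letter_value G g (i, b) = (if b then g i else inv\<^bsub>G\<^esub> (g i))"

definition word_value :: "('a, 'b) monoid_scheme \<Rightarrow> ('i \<Rightarrow> 'a) \<Rightarrow> 'i letter list \<Rightarrow> 'a" where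
  "word_value G g w = foldr (\<lambda>a x. letter_value G g a \<otimes>\<^bsub>G\<^esub> x) w \<one>\<^bsub>G\<^esub>"

context group
begin

lemma letter_value_closed: "g \<in> I \<rightarrow> carrier G \<Longrightarrow> fst a \<in> I \<Longrightarrow> letter_value G g a \<in> carrier G"
  by (cases a) auto

lemma word_value_closed:
  "g \<in> I \<rightarrow> carrier G \<Longrightarrow> fst ` set w \<subseteq> I \<Longrightarrow> word_value G g w \<in> carrier G"
  by (induction w) (auto simp: word_value_def letter_value_closed)

lemma word_value_cons_cancel:
  assumes g: "g \<in> I \<rightarrow> carrier G" and "fst a \<in> I" "fst ` set w \<subseteq> I"
  shows "word_value G g (cons_cancel a w) = letter_value G g a \<otimes> word_value G g w"
proof (cases w)
  case (Cons b v)
  show ?thesis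
  proof (cases "b = letter_inv a")
    case True
    have v: "word_value G g v \<in> carrier G"
      using assms Cons word_value_closed[OF g] by auto
    have a: "letter_value G g a \<in> carrier G" and b: "letter_value G g b \<in> carrier G"
      using assms Cons letter_value_closed[OF g] by auto
    have "letter_value G g a \<otimes> letter_value G g b = \<one>"
      using True assms by (cases a) (auto simp: letter_inv_def Pi_iff r_inv l_inv)
    then have "letter_value G g a \<otimes> (letter_value G g b \<otimes> word_value G g v) = word_value G g v"
      using a b v by (simp flip: m_assoc)
    then show ?thesis using True Cons by (simp add: word_value_def)
  qed (use Cons in \<open>simp add: word_value_def\<close>)
qed (simp add: word_value_def)

lemma word_value_mult:
  assumes g: "g \<in> I \<rightarrow> carrier G" and "fst ` set u \<subseteq> I" "fst ` set v \<subseteq> I"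
  shows "word_value G g (foldr cons_cancel u v) = word_value G g u \<otimes> word_value G g v"
  using assms(2)
proof (induction u)
  case Nil
  then show ?case using word_value_closed[OF g assms(3)] by (simp add: word_value_def)
next
  case (Cons a u)
  have "fst ` set (foldr cons_cancel u v) \<subseteq> I"
    using set_foldr_cons_cancel[of u v] Cons.prems assms(3) by fastforce
  then have "word_value G g (foldr cons_cancel (a # u) v)
      = letter_value G g a \<otimes> word_value G g (foldr cons_cancel u v)"
    using word_value_cons_cancel[OF g] Cons.prems by simp
  also have "\<dots> = letter_value G g a \<otimes> (word_value G g u \<otimes> word_value G g v)"
    using Cons by simp
  also have "\<dots> = letter_value G g a \<otimes> word_value G g u \<otimes> word_value G g v"
    using letter_value_closed[OF g] word_value_closed[OF g] Cons.prems assms(3)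
    by (simp add: m_assoc)
  also have "\<dots> = word_value G g (a # u) \<otimes> word_value G g v"
    by (simp add: word_value_def)
  finally show ?case .
qed

lemma word_value_hom: "g \<in> I \<rightarrow> carrier G \<Longrightarrow> word_value G g \<in> hom (free_group I) G"
  by (auto simp: hom_def free_group_def word_value_closed word_value_mult)

lemma word_value_free_gen: "g i \<in> carrier G \<Longrightarrow> word_value G g (free_gen i) = g i"
  by (simp add: word_value_def free_gen_def)

lemma free_hom_unique:
  assumes h: "h \<in> hom (free_group I) G" "\<And>i. i \<in> I \<Longrightarrow> h (free_gen i) = g i"
    and "w \<in> carrier (free_group I)"
  shows "h w = word_value G g w"
  using assms(3)
proof (induction w)
  interpret F: group "free_group I" by (rule group_free_group)
  interpret h: group_hom "free_group I" G h
    using h(1) by unfold_locales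
  {
    case Nil
    show ?case using h.hom_one by (simp add: free_group_def word_value_def)
  next
    case (Cons a w)
    obtain i b where a: "a = (i, b)" by (cases a)
    have i: "i \<in> I" and w: "w \<in> carrier (free_group I)"
      using Cons.prems a by (auto simp: free_group_def reduced_Cons)
    have aF: "[a] \<in> carrier (free_group I)"
      using i a by (simp add: free_group_def)
    have "a # w = [a] \<otimes>\<^bsub>free_group I\<^esub> w"
      using Cons.prems by (cases w) (auto simp: free_group_def reduced_Cons)
    then have "h (a # w) = h [a] \<otimes> h w"
      using h.hom_mult[OF aF w] by simp
    moreover have "h [a] = letter_value G g a"
    proof (cases b)
      case True
      then show ?thesis using h(2)[OF i] a by (simp add: free_gen_def)
    next
      case False
      have "[a] \<otimes>\<^bsub>free_group I\<^esub> free_gen i = \<one>\<^bsub>free_group I\<^esub>"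
        using False a by (simp add: free_group_def free_gen_def letter_inv_def)
      then have "[a] = inv\<^bsub>free_group I\<^esub> free_gen i"
        using F.inv_equality[OF _ free_gen_closed[OF i] aF] by simp
      then show ?thesis
        using h.hom_inv[OF free_gen_closed[OF i]] h(2)[OF i] a False by simp
    qed
    ultimately show ?case using Cons.IH[OF w] by (simp add: word_value_def)
  }
qed

theorem free_hom_eq:
  assumes g: "g \<in> I \<rightarrow> carrier G"
  shows "free_hom G I g = restrict (word_value G g) (carrier (free_group I))"
  unfolding free_hom_def
proof (rule the_equality)
  interpret F: group "free_group I" by (rule group_free_group)
  let ?h = "restrict (word_value G g) (carrier (free_group I))"
  have "?h \<in> hom (free_group I) G"
    using word_value_hom[OF g] F.m_closed by (auto simp: hom_def)
  moreover have "?h (free_gen i) = g i" if "i \<in> I" for i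
    using that g free_gen_closed[OF that] word_value_free_gen[of g i] by auto
  ultimately show "?h \<in> hom (free_group I) G \<and> ?h \<in> extensional (carrier (free_group I))
      \<and> (\<forall>i\<in>I. ?h (free_gen i) = g i)"
    by auto
next
  fix h assume "h \<in> hom (free_group I) G \<and> h \<in> extensional (carrier (free_group I))
      \<and> (\<forall>i\<in>I. h (free_gen i) = g i)"
  then show "h = restrict (word_value G g) (carrier (free_group I))"
    using free_hom_unique[of h I g] by (auto intro!: extensionalityI)
qed

end

definition word_count :: "('a, 'b) monoid_scheme \<Rightarrow> nat \<Rightarrow> nat letter list \<Rightarrow> 'a \<Rightarrow> nat" where
  "word_count G k w x = card {g \<in> {1..k} \<rightarrow>\<^sub>E carrier G. free_hom G {1..k} g w = x}"

definition rational_pair :: "('a, 'b) monoid_scheme \<Rightarrow> nat \<Rightarrow> nat letter list \<Rightarrow> bool" where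
  "rational_pair G k w \<longleftrightarrow>
     (\<forall>g\<in>carrier G. \<forall>e::int. coprime e (int (order G)) \<longrightarrow>
        word_count G k w g = word_count G k w (g [^]\<^bsub>G\<^esub> e))"

definition rational_group :: "('a, 'b) monoid_scheme \<Rightarrow> bool" where
  "rational_group G \<longleftrightarrow> (\<forall>k. \<forall>w\<in>carrier (free_group {1..k}). rational_pair G k w)"


section \<open>Nilpotent groups\<close>

text \<open>
  The lower central series is indexed from \<open>0\<close>, so that the nilpotency class is the least index
  at which it is trivial; the trivial group has class \<open>0\<close>. The commutator convention is the one
  of \<open>derived_set\<close>.
\<close>

primrec lower_central :: "('a, 'b) monoid_scheme \<Rightarrow> nat \<Rightarrow> 'a set" where
  "lower_central G 0 = carrier G"
| "lower_central G (Suc n) = generate G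
     (\<Union>x\<in>lower_central G n. \<Union>y\<in>carrier G. {x \<otimes>\<^bsub>G\<^esub> y \<otimes>\<^bsub>G\<^esub> inv\<^bsub>G\<^esub> x \<otimes>\<^bsub>G\<^esub> inv\<^bsub>G\<^esub> y})"

definition nilpotent :: "('a, 'b) monoid_scheme \<Rightarrow> bool" where
  "nilpotent G \<longleftrightarrow> (\<exists>n. lower_central G n = {\<one>\<^bsub>G\<^esub>})"

definition nilpotency_class :: "('a, 'b) monoid_scheme \<Rightarrow> nat" where
  "nilpotency_class G = (LEAST n. lower_central G n = {\<one>\<^bsub>G\<^esub>})"

end

theory Submission
  imports Defs
begin

text \<open>
  It suffices to find a permutation \<open>\<phi>\<close> of the tuples with \<open>w (\<phi> g) = w g ^ e\<close>. Nielsen moves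
  \<open>x\<^sub>j \<mapsto> x\<^sub>j x\<^sub>i\<^sup>\<plusminus>\<^sup>1\<close> permute the tuples and perform the Euclidean algorithm on the exponent sums of a
  word. Since commutators are central and bilinear, repeated use of such moves on the variables not
  yet treated brings \<open>w\<close> into the form
  \<open>x\<^sub>1\<^sup>d [x\<^sub>1, x\<^sub>2]\<^sup>s [x\<^sub>2, x\<^sub>3]\<^sup>t \<dots>\<close>. For such a word, raising
  every other variable \<open>x\<^sub>1, x\<^sub>3, \<dots>\<close> to the power \<open>e\<close> raises the value to the power \<open>e\<close>.
\<close>

section \<open>Exponent sums and Nielsen moves\<close>

text \<open>The coordinate of \<open>w\<close> at \<open>i\<close> in the abelianisation of the free
  group. It is defined on all lists of letters, because the words formed below need not be
  reduced.\<close>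

definition exponent_sum :: "'i \<Rightarrow> 'i letter list \<Rightarrow> int" where
  "exponent_sum i w = (\<Sum>a\<leftarrow>w. if fst a = i then if snd a then 1 else - 1 else 0)"

lemma exponent_sum_Nil [simp]: "exponent_sum i [] = 0"
  by (simp add: exponent_sum_def)

lemma exponent_sum_Cons [simp]:
  "exponent_sum i (a # w) =
     (if fst a = i then if snd a then 1 else - 1 else 0) + exponent_sum i w"
  by (simp add: exponent_sum_def)

lemma exponent_sum_append [simp]: "exponent_sum i (u @ v) = exponent_sum i u + exponent_sum i v"
  by (induction u) auto

lemma exponent_sum_filter:
  "exponent_sum j (filter (\<lambda>a. fst a \<noteq> i) w) = (if j = i then 0 else exponent_sum j w)"
  by (induction w) auto

text \<open>The substitution of \<open>x_j\<close> by \<open>x_j b\<close>. Since \<open>b\<close>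
  is a letter, both signs of a Nielsen move are covered at once. Nothing is cancelled: evaluation in
  a group does not require reduced words.\<close>

fun nielsen_letter :: "'i \<Rightarrow> 'i letter \<Rightarrow> 'i letter \<Rightarrow> 'i letter list" where
  "nielsen_letter j b (k, c) =
     (if k \<noteq> j then [(k, c)] else if c then [(j, True), b] else [letter_inv b, (j, False)])"

definition nielsen_word :: "'i \<Rightarrow> 'i letter \<Rightarrow> 'i letter list \<Rightarrow> 'i letter list" where
  "nielsen_word j b w = concat (map (nielsen_letter j b) w)"

lemma nielsen_word_Nil [simp]: "nielsen_word j b [] = []"
  and nielsen_word_Cons [simp]:
    "nielsen_word j b (a # w) = nielsen_letter j b a @ nielsen_word j b w"
  by (simp_all add: nielsen_word_def)

lemma nielsen_word_variables:
  "fst ` set w \<subseteq> J \<Longrightarrow> fst b \<in> J \<Longrightarrow> fst ` set (nielsen_word j b w) \<subseteq> J"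
  by (induction w) (auto simp: letter_inv_def split: if_splits)

text \<open>Each occurrence of \<open>x_j\<close> brings along one copy of \<open>b\<close>,
  inverted exactly when the occurrence is. This is the elementary step of the Euclidean algorithm on
  exponent sums.\<close>

lemma exponent_sum_nielsen_word:
  assumes "fst b \<noteq> j"
  shows "exponent_sum p (nielsen_word j b w) = exponent_sum p w +
     (if p = fst b then if snd b then exponent_sum j w else - exponent_sum j w else 0)"
proof (induction w)
  case (Cons a w)
  obtain k c where "a = (k, c)" by fastforce
  with Cons assms show ?case by (auto simp: letter_inv_def)
qed auto

section \<open>Evaluation of words\<close>

lemma word_value_Nil [simp]: "word_value G g [] = \<one>\<^bsub>G\<^esub>"
  and word_value_Cons [simp]:
    "word_value G g (a # w) = letter_value G g a \<otimes>\<^bsub>G\<^esub> word_value G g w"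
  by (simp_all add: word_value_def)

lemma letter_value_cong: "g (fst a) = h (fst a) \<Longrightarrow> letter_value G g a = letter_value G h a"
  by (cases a) auto

lemma word_value_cong:
  "(\<And>i. i \<in> fst ` set w \<Longrightarrow> g i = h i) \<Longrightarrow> word_value G g w = word_value G h w"
proof (induction w)
  case (Cons a w)
  have "letter_value G g a = letter_value G h a"
    using Cons.prems by (intro letter_value_cong) simp
  with Cons show ?case by simp
qed simp

context group
begin

lemma word_value_append:
  assumes "g \<in> J \<rightarrow> carrier G" "fst ` set u \<subseteq> J" "fst ` set v \<subseteq> J"
  shows "word_value G g (u @ v) = word_value G g u \<otimes> word_value G g v"
  using assms
  by (induction u) (auto simp: m_assoc letter_value_closed[OF assms(1)] word_value_closed[OF assms(1)])

lemma letter_value_inv: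
  "g (fst a) \<in> carrier G \<Longrightarrow> letter_value G g (letter_inv a) = inv (letter_value G g a)"
  by (cases a) (auto simp: letter_inv_def)

lemma letter_value_int_pow:
  assumes "g (fst a) \<in> carrier G"
  shows "letter_value G g a = g (fst a) [^] (if snd a then 1 else - 1 :: int)"
  using assms by (cases a) (auto simp: int_pow_neg)

lemma word_value_replicate:
  assumes "letter_value G g a \<in> carrier G"
  shows "word_value G g (replicate n a) = letter_value G g a [^] n"
  using assms by (induction n) (simp, metis nat_pow_Suc2 replicate_Suc word_value_Cons)

text \<open>The word repeats \<open>a\<close> or its inverse and is chosen before the tuple
  \<open>g\<close>. This uniformity is what lets powers of letters be absorbed into a fixed word
  when a variable is collected.\<close>

lemma letter_power_word:
  obtains u where "fst ` set u \<subseteq> {fst a}"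
    and "\<And>g. g (fst a) \<in> carrier G \<Longrightarrow> word_value G g u = letter_value G g a [^] (n :: int)"
proof (cases "n \<ge> 0")
  case True
  show ?thesis
  proof (rule that[of "replicate (nat n) a"])
    fix g assume g: "g (fst a) \<in> carrier G"
    have "letter_value G g a \<in> carrier G"
      using letter_value_closed[of g "{fst a}" a] g by simp
    then show "word_value G g (replicate (nat n) a) = letter_value G g a [^] n"
      using True by (simp add: word_value_replicate pow_nat)
  qed auto
next
  case False
  show ?thesis
  proof (rule that[of "replicate (nat (- n)) (letter_inv a)"])
    fix g assume g: "g (fst a) \<in> carrier G"
    have l: "letter_value G g a \<in> carrier G"
      using letter_value_closed[of g "{fst a}" a] g by simp
    have "word_value G g (replicate (nat (- n)) (letter_inv a)) = inv (letter_value G g a) [^] (- n)"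
      using False l g by (simp add: word_value_replicate letter_value_inv pow_nat)
    also have "\<dots> = letter_value G g a [^] n"
      using l by (simp add: int_pow_neg int_pow_inv)
    finally show "word_value G g (replicate (nat (- n)) (letter_inv a)) = letter_value G g a [^] n" .
  qed auto
qed

section \<open>Nielsen moves on tuples and the Euclidean algorithm\<close>

definition nielsen_tuple :: "'i \<Rightarrow> 'i letter \<Rightarrow> ('i \<Rightarrow> 'a) \<Rightarrow> 'i \<Rightarrow> 'a" where
  "nielsen_tuple j b g = g(j := g j \<otimes> letter_value G g b)"

lemma nielsen_tuple_PiE:
  assumes "j \<in> J" "fst b \<in> J" "g \<in> J \<rightarrow>\<^sub>E carrier G"
  shows "nielsen_tuple j b g \<in> J \<rightarrow>\<^sub>E carrier G"
proof -
  have "letter_value G g b \<in> carrier G"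
    using assms letter_value_closed[of g J b] by auto
  then show ?thesis
    using assms by (auto simp: nielsen_tuple_def PiE_iff extensional_def)
qed

text \<open>The move changes only coordinate \<open>j\<close>, which differs from
  \<open>fst b\<close>, so the value of \<open>b\<close> is the same before and after it and can be
  cancelled.\<close>

lemma nielsen_tuple_letter_inv:
  assumes "j \<in> J" "fst b \<in> J" "fst b \<noteq> j" "g \<in> J \<rightarrow>\<^sub>E carrier G"
  shows "nielsen_tuple j (letter_inv b) (nielsen_tuple j b g) = g"
proof -
  have l: "letter_value G g b \<in> carrier G" and gj: "g j \<in> carrier G" "g (fst b) \<in> carrier G"
    using assms letter_value_closed[of g J b] by auto
  have "letter_value G (nielsen_tuple j b g) (letter_inv b) = letter_value G g (letter_inv b)"
    using assms by (intro letter_value_cong) (simp add: nielsen_tuple_def)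
  then have "letter_value G (nielsen_tuple j b g) (letter_inv b) = inv (letter_value G g b)"
    using letter_value_inv gj by simp
  moreover have "g j \<otimes> letter_value G g b \<otimes> inv (letter_value G g b) = g j"
    using l gj by (simp add: m_assoc)
  ultimately show ?thesis
    by (simp add: nielsen_tuple_def)
qed

lemma bij_betw_nielsen_tuple:
  assumes "j \<in> J" "fst b \<in> J" "fst b \<noteq> j"
  shows "bij_betw (nielsen_tuple j b) (J \<rightarrow>\<^sub>E carrier G) (J \<rightarrow>\<^sub>E carrier G)"
proof (rule bij_betw_byWitness[where f' = "nielsen_tuple j (letter_inv b)"])
  show "\<forall>g\<in>J \<rightarrow>\<^sub>E carrier G. nielsen_tuple j (letter_inv b) (nielsen_tuple j b g) = g"
    using nielsen_tuple_letter_inv[OF assms] by blast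
  show "\<forall>g\<in>J \<rightarrow>\<^sub>E carrier G. nielsen_tuple j b (nielsen_tuple j (letter_inv b) g) = g"
    using nielsen_tuple_letter_inv[of j J "letter_inv b"] assms by simp
  show "nielsen_tuple j b ` (J \<rightarrow>\<^sub>E carrier G) \<subseteq> J \<rightarrow>\<^sub>E carrier G"
    using nielsen_tuple_PiE[OF assms(1,2)] by blast
  show "nielsen_tuple j (letter_inv b) ` (J \<rightarrow>\<^sub>E carrier G) \<subseteq> J \<rightarrow>\<^sub>E carrier G"
    using nielsen_tuple_PiE[of j J "letter_inv b"] assms by (simp add: image_subset_iff)
qed

text \<open>Moving the tuple amounts to substituting in the word, letter by letter. The
  correspondence is contravariant: composing moves on tuples composes substitutions in the opposite
  order.\<close>

lemma word_value_nielsen_tuple: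
  assumes "j \<in> J" "fst b \<in> J" "fst b \<noteq> j" "g \<in> J \<rightarrow>\<^sub>E carrier G" "fst ` set w \<subseteq> J"
  shows "word_value G (nielsen_tuple j b g) w = word_value G g (nielsen_word j b w)"
  using assms(5)
proof (induction w)
  case (Cons a w)
  have g: "g \<in> J \<rightarrow> carrier G" using assms by auto
  have l: "letter_value G g b \<in> carrier G" and gj: "g j \<in> carrier G" "g (fst b) \<in> carrier G"
    using assms letter_value_closed[OF g] by auto
  obtain k c where a: "a = (k, c)" by fastforce
  then have k: "k \<in> J" "g k \<in> carrier G" using Cons.prems g by auto
  have sub: "fst ` set (nielsen_letter j b a) \<subseteq> J"
    using a k assms by auto
  have "letter_value G (nielsen_tuple j b g) a = word_value G g (nielsen_letter j b a)"
    using a k l gj by (auto simp: nielsen_tuple_def letter_value_inv inv_mult_group)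
  then show ?case
    using Cons word_value_append[OF g sub nielsen_word_variables] assms by simp
qed simp

text \<open>Euclidean algorithm: while two variables have nonzero exponent sum in \<open>u\<close>,
  the sum of smaller absolute value is added to or subtracted from the larger. The permutation
  \<open>\<psi>\<close> and the substitution \<open>s\<close> record the same sequence of moves.
  They are described on all words, so that a second word with vanishing sums can be carried
  along.\<close>

lemma exponent_sum_concentrate:
  fixes J :: "'i set"
  assumes "finite J" "J \<noteq> {}" "fst ` set u \<subseteq> J"
  obtains \<psi> s m where "m \<in> J"
    and "bij_betw \<psi> (J \<rightarrow>\<^sub>E carrier G) (J \<rightarrow>\<^sub>E carrier G)"
    and "\<And>w. fst ` set w \<subseteq> J \<Longrightarrow> fst ` set (s w) \<subseteq> J"
    and "\<And>w g. fst ` set w \<subseteq> J \<Longrightarrow> g \<in> J \<rightarrow>\<^sub>E carrier G \<Longrightarrow>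
           word_value G (\<psi> g) w = word_value G g (s w)"
    and "\<And>w. \<forall>j\<in>J. exponent_sum j w = 0 \<Longrightarrow> \<forall>j\<in>J. exponent_sum j (s w) = 0"
    and "\<forall>j\<in>J - {m}. exponent_sum j (s u) = 0"
proof -
  \<comment> \<open>The part of the conclusion that mentions neither \<open>u\<close> nor
    \<open>m\<close>, and is therefore preserved when a further move is composed.\<close>
  define good where "good \<psi> s \<longleftrightarrow> bij_betw \<psi> (J \<rightarrow>\<^sub>E carrier G) (J \<rightarrow>\<^sub>E carrier G)
      \<and> (\<forall>w. fst ` set w \<subseteq> J \<longrightarrow> fst ` set (s w) \<subseteq> J)
      \<and> (\<forall>w g. fst ` set w \<subseteq> J \<longrightarrow> g \<in> J \<rightarrow>\<^sub>E carrier G \<longrightarrow>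
           word_value G (\<psi> g) w = word_value G g (s w))
      \<and> (\<forall>w. (\<forall>j\<in>J. exponent_sum j w = 0) \<longrightarrow> (\<forall>j\<in>J. exponent_sum j (s w) = 0))"
    for \<psi> s
  have "\<exists>\<psi> s m. m \<in> J \<and> good \<psi> s \<and> (\<forall>j\<in>J - {m}. exponent_sum j (s u) = 0)"
    using assms(3)
  proof (induction "\<Sum>j\<in>J. nat \<bar>exponent_sum j u\<bar>" arbitrary: u rule: less_induct)
    case less
    show ?case
    proof (cases "\<exists>m\<in>J. \<forall>j\<in>J - {m}. exponent_sum j u = 0")
      case True
      moreover have "good id id" by (simp add: good_def)
      ultimately show ?thesis by (metis id_apply)
    next
      case False
      obtain k where k: "k \<in> J" using assms by blast
      then obtain i where i: "i \<in> J" "exponent_sum i u \<noteq> 0" using False by blast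
      then obtain j where j: "j \<in> J" "j \<noteq> i" "exponent_sum j u \<noteq> 0" using False by blast
      \<comment> \<open>\<open>p\<close> and \<open>q\<close> are \<open>i\<close> and
        \<open>j\<close>, ordered by the absolute value of their exponent sums.\<close>
      obtain p q where pq: "p \<in> J" "q \<in> J" "p \<noteq> q" "exponent_sum q u \<noteq> 0"
        "\<bar>exponent_sum q u\<bar> \<le> \<bar>exponent_sum p u\<bar>"
        using i j by (metis linear)
      \<comment> \<open>The move replaces \<open>x_q\<close> by \<open>x_q b\<close>. Its sign
        pushes the sum of \<open>x_p\<close> towards zero by the absolute value of that of
        \<open>x_q\<close>; as the latter is nonzero and not the larger of the two, the absolute
        value at \<open>p\<close> drops.\<close>
      define b where "b = (p, (exponent_sum p u > 0) \<noteq> (exponent_sum q u > 0))"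
      have b: "q \<in> J" "fst b \<in> J" "fst b \<noteq> q" using pq by (auto simp: b_def)
      let ?v = "nielsen_word q b u"
      have expv: "exponent_sum r ?v = exponent_sum r u +
          (if r = p then if snd b then exponent_sum q u else - exponent_sum q u else 0)" for r
        using exponent_sum_nielsen_word[OF b(3), of r u] by (simp add: b_def)
      have "(\<Sum>j\<in>J. nat \<bar>exponent_sum j ?v\<bar>) < (\<Sum>j\<in>J. nat \<bar>exponent_sum j u\<bar>)"
      proof (rule sum_strict_mono_ex1)
        have *: "nat \<bar>exponent_sum p ?v\<bar> < nat \<bar>exponent_sum p u\<bar>"
          using pq unfolding expv by (auto simp: b_def)
        then show "\<exists>a\<in>J. nat \<bar>exponent_sum a ?v\<bar> < nat \<bar>exponent_sum a u\<bar>"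
          using pq by blast
        show "\<forall>x\<in>J. nat \<bar>exponent_sum x ?v\<bar> \<le> nat \<bar>exponent_sum x u\<bar>"
        proof
          fix x show "nat \<bar>exponent_sum x ?v\<bar> \<le> nat \<bar>exponent_sum x u\<bar>"
            using * by (cases "x = p") (auto simp: expv)
        qed
      qed (use assms in auto)
      then obtain \<psi> s m where IH: "m \<in> J" "good \<psi> s"
        "\<forall>j\<in>J - {m}. exponent_sum j (s ?v) = 0"
        using less.hyps[OF _ nielsen_word_variables[OF less.prems b(2)]] by blast
      have \<psi>: "\<psi> g \<in> J \<rightarrow>\<^sub>E carrier G" if "g \<in> J \<rightarrow>\<^sub>E carrier G" for g
        using IH(2) that unfolding good_def by (metis bij_betwE)
      \<comment> \<open>By contravariance the new move acts first on words and last on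
        tuples.\<close>
      have "good (nielsen_tuple q b \<circ> \<psi>) (s \<circ> nielsen_word q b)"
        unfolding good_def
      proof (intro conjI allI impI)
        show "bij_betw (nielsen_tuple q b \<circ> \<psi>) (J \<rightarrow>\<^sub>E carrier G) (J \<rightarrow>\<^sub>E carrier G)"
          using IH(2) bij_betw_nielsen_tuple[OF b] unfolding good_def by (blast intro: bij_betw_trans)
      next
        fix w :: "'i letter list" assume "fst ` set w \<subseteq> J"
        then show "fst ` set ((s \<circ> nielsen_word q b) w) \<subseteq> J"
          using IH(2) nielsen_word_variables[OF _ b(2)] unfolding good_def by simp
      next
        fix w :: "'i letter list" and g assume w: "fst ` set w \<subseteq> J" and g: "g \<in> J \<rightarrow>\<^sub>E carrier G"
        then show "word_value G ((nielsen_tuple q b \<circ> \<psi>) g) w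
            = word_value G g ((s \<circ> nielsen_word q b) w)"
          using word_value_nielsen_tuple[OF b \<psi>[OF g] w] nielsen_word_variables[OF w b(2), of q] IH(2)
          unfolding good_def by simp
      next
        fix w :: "'i letter list" assume "\<forall>j\<in>J. exponent_sum j w = 0"
        then have "\<forall>j\<in>J. exponent_sum j (nielsen_word q b w) = 0"
          using b by (simp add: exponent_sum_nielsen_word)
        then show "\<forall>j\<in>J. exponent_sum j ((s \<circ> nielsen_word q b) w) = 0"
          using IH(2) unfolding good_def by simp
      qed
      with IH show ?thesis by (metis comp_apply)
    qed
  qed
  then obtain \<psi> s m where m: "m \<in> J" and good: "good \<psi> s"
    and u: "\<forall>j\<in>J - {m}. exponent_sum j (s u) = 0"
    by blast
  show thesis
    by (rule that[of m \<psi> s])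
      (use m good u in \<open>simp_all add: good_def\<close>)
qed

section \<open>Power maps and their extension to tuples\<close>

text \<open>A Bezout coefficient \<open>a\<close> of \<open>e\<close> modulo the group order gives a
  left inverse, raising to the power \<open>a\<close>.\<close>

lemma inj_on_int_pow:
  assumes "finite (carrier G)" "coprime e (int (order G))"
  shows "inj_on (\<lambda>x. x [^] e) (carrier G)"
proof -
  obtain a b where ab: "a * e + b * int (order G) = 1"
    using assms(2) by (metis bezout_int coprime_iff_gcd_eq_1)
  have "(x [^] e) [^] a = x" if x: "x \<in> carrier G" for x
  proof -
    have "x = x [^] (e * a + int (order G) * b)"
      using x ab by (simp add: mult.commute)
    also have "\<dots> = (x [^] e) [^] a \<otimes> (x [^] int (order G)) [^] b"
      using x by (simp add: int_pow_mult int_pow_pow)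
    also have "\<dots> = (x [^] e) [^] a"
      using x pow_order_eq_1[OF x] by (simp add: int_pow_int int_pow_closed)
    finally show ?thesis by simp
  qed
  then show ?thesis by (rule inj_on_inverseI)
qed

text \<open>The product of \<open>\<phi>\<close> on the coordinates other than \<open>m\<close> with
  the power map on coordinate \<open>m\<close>. Both are injective, and an injective self-map of the
  finite set of tuples is bijective.\<close>

lemma bij_betw_extend_tuple:
  assumes "finite (carrier G)" "finite J" "m \<in> J" "coprime e (int (order G))"
    and \<phi>: "bij_betw \<phi> (J - {m} \<rightarrow>\<^sub>E carrier G) (J - {m} \<rightarrow>\<^sub>E carrier G)"
  shows "bij_betw (\<lambda>g. (\<phi> (restrict g (J - {m})))(m := g m [^] e))
    (J \<rightarrow>\<^sub>E carrier G) (J \<rightarrow>\<^sub>E carrier G)"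
proof -
  let ?f = "\<lambda>g. (\<phi> (restrict g (J - {m})))(m := g m [^] e)"
  let ?A = "J \<rightarrow>\<^sub>E carrier G" and ?B = "J - {m} \<rightarrow>\<^sub>E carrier G"
  have res: "restrict g (J - {m}) \<in> ?B" if "g \<in> ?A" for g
    using that by auto
  have into: "?f ` ?A \<subseteq> ?A"
  proof (rule image_subsetI)
    fix g assume g: "g \<in> ?A"
    have "\<phi> (restrict g (J - {m})) \<in> ?B" using bij_betwE[OF \<phi>] res[OF g] by blast
    moreover have "g m [^] e \<in> carrier G" using g assms by auto
    ultimately have "?f g \<in> insert m (J - {m}) \<rightarrow>\<^sub>E carrier G" by (intro PiE_fun_upd)
    then show "?f g \<in> ?A" using assms(3) by (simp add: insert_absorb)
  qed
  have inj: "inj_on ?f ?A"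
  proof (rule inj_onI)
    fix g h assume g: "g \<in> ?A" and h: "h \<in> ?A" and eq: "?f g = ?f h"
    have B: "\<phi> (restrict g (J - {m})) \<in> ?B" "\<phi> (restrict h (J - {m})) \<in> ?B"
      by (fact bspec[OF bij_betwE[OF \<phi>] res[OF g]] bspec[OF bij_betwE[OF \<phi>] res[OF h]])+
    have "\<phi> (restrict g (J - {m})) = \<phi> (restrict h (J - {m}))"
    proof (rule PiE_ext[OF B])
      fix x assume "x \<in> J - {m}"
      then show "\<phi> (restrict g (J - {m})) x = \<phi> (restrict h (J - {m})) x"
        using fun_cong[OF eq, of x] by simp
    qed
    then have r: "restrict g (J - {m}) = restrict h (J - {m})"
      by (rule inj_onD[OF bij_betw_imp_inj_on[OF \<phi>] _ res[OF g] res[OF h]])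
    have "g m [^] e = h m [^] e" using fun_cong[OF eq, of m] by simp
    then have m: "g m = h m"
      by (rule inj_onD[OF inj_on_int_pow[OF assms(1,4)] _ PiE_mem[OF g assms(3)] PiE_mem[OF h assms(3)]])
    show "g = h"
    proof (rule PiE_ext[OF g h])
      fix x assume "x \<in> J"
      then show "g x = h x" using fun_cong[OF r, of x] m by (cases "x = m") auto
    qed
  qed
  have "finite ?A" using assms by (simp add: finite_PiE)
  then show ?thesis using endo_inj_surj[OF _ into inj] inj by (simp add: bij_betw_def)
qed

end

section \<open>Words in groups with central commutators\<close>

text \<open>Nilpotency class at most 2 in elementwise form, suited to calculation; the lower central
  series enters only in the final theorem.\<close>

locale central_comm_group = group +
  assumes comm_central: "\<lbrakk>x \<in> carrier G; y \<in> carrier G; z \<in> carrier G\<rbrakk> \<Longrightarrow>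
    (x \<otimes> y \<otimes> inv x \<otimes> inv y) \<otimes> z = z \<otimes> (x \<otimes> y \<otimes> inv x \<otimes> inv y)"
begin

definition comm :: "'a \<Rightarrow> 'a \<Rightarrow> 'a" where
  "comm x y = x \<otimes> y \<otimes> inv x \<otimes> inv y"

lemma comm_closed [simp]: "x \<in> carrier G \<Longrightarrow> y \<in> carrier G \<Longrightarrow> comm x y \<in> carrier G"
  by (simp add: comm_def)

lemma comm_commute:
  "\<lbrakk>x \<in> carrier G; y \<in> carrier G; z \<in> carrier G\<rbrakk> \<Longrightarrow> z \<otimes> comm x y = comm x y \<otimes> z"
  using comm_central by (simp add: comm_def)

lemma mult_eq_comm_mult:
  assumes "x \<in> carrier G" "y \<in> carrier G"
  shows "x \<otimes> y = comm x y \<otimes> (y \<otimes> x)"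
proof -
  have "inv y \<otimes> (y \<otimes> x) = x" using assms by (simp flip: m_assoc)
  then show ?thesis using assms by (simp add: comm_def m_assoc)
qed

text \<open>Right cancellation. A commutator can thus be identified by verifying a single equation
  of this shape.\<close>

lemma comm_unique:
  assumes "x \<in> carrier G" "y \<in> carrier G" "c \<in> carrier G" "x \<otimes> y = c \<otimes> (y \<otimes> x)"
  shows "comm x y = c"
  using assms mult_eq_comm_mult[of x y] by (metis comm_closed m_closed right_cancel)

text \<open>Move \<open>x\<close> past \<open>y\<close> and then past \<open>z\<close>; the second
  commutator is central and slides to the left past \<open>y\<close>.\<close>

lemma comm_mult_right:
  assumes "x \<in> carrier G" "y \<in> carrier G" "z \<in> carrier G"
  shows "comm x (y \<otimes> z) = comm x y \<otimes> comm x z"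
proof (rule comm_unique)
  have "x \<otimes> (y \<otimes> z) = (x \<otimes> y) \<otimes> z" using assms by (simp add: m_assoc)
  also have "\<dots> = comm x y \<otimes> (y \<otimes> (x \<otimes> z))"
    using assms mult_eq_comm_mult[of x y] by (simp add: m_assoc)
  also have "\<dots> = comm x y \<otimes> ((y \<otimes> comm x z) \<otimes> (z \<otimes> x))"
    using assms mult_eq_comm_mult[of x z] by (simp add: m_assoc)
  also have "y \<otimes> comm x z = comm x z \<otimes> y"
    using assms by (intro comm_commute)
  also have "comm x y \<otimes> (comm x z \<otimes> y \<otimes> (z \<otimes> x)) = comm x y \<otimes> comm x z \<otimes> (y \<otimes> z \<otimes> x)"
    using assms by (simp add: m_assoc)
  finally show "x \<otimes> (y \<otimes> z) = comm x y \<otimes> comm x z \<otimes> (y \<otimes> z \<otimes> x)" .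
qed (use assms in auto)

lemma comm_inv:
  assumes "x \<in> carrier G" "y \<in> carrier G"
  shows "inv (comm x y) = comm y x"
  using assms by (simp add: comm_def inv_mult_group m_assoc)

text \<open>Follows from linearity on the right, since inverting a commutator swaps its
  arguments.\<close>

lemma comm_mult_left:
  assumes "x \<in> carrier G" "y \<in> carrier G" "z \<in> carrier G"
  shows "comm (x \<otimes> y) z = comm x z \<otimes> comm y z"
proof -
  have "comm (x \<otimes> y) z = inv (comm z x \<otimes> comm z y)"
    using assms by (simp flip: comm_mult_right add: comm_inv)
  also have "\<dots> = comm y z \<otimes> comm x z"
    using assms by (simp add: inv_mult_group comm_inv)
  also have "\<dots> = comm x z \<otimes> comm y z"
    using assms by (intro comm_commute) simp_all
  finally show ?thesis .
qed

text \<open>Linearity makes \<open>comm x\<close> an endomorphism of the group, and homomorphisms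
  respect integer powers.\<close>

lemma comm_int_pow_right:
  assumes "x \<in> carrier G" "y \<in> carrier G"
  shows "comm x (y [^] (n :: int)) = comm x y [^] n"
proof -
  interpret h: group_hom G G "comm x"
    using assms by unfold_locales (auto simp: hom_def comm_mult_right)
  show ?thesis using h.hom_int_pow assms by simp
qed

lemma comm_int_pow_left:
  assumes "x \<in> carrier G" "y \<in> carrier G"
  shows "comm (x [^] (n :: int)) y = comm x y [^] n"
proof -
  interpret h: group_hom G G "\<lambda>x. comm x y"
    using assms by unfold_locales (auto simp: hom_def comm_mult_left)
  show ?thesis using h.hom_int_pow assms by simp
qed

lemma comm_one_right [simp]: "x \<in> carrier G \<Longrightarrow> comm x \<one> = \<one>"
  by (simp add: comm_def)

lemma comm_comm_right:
  assumes "x \<in> carrier G" "y \<in> carrier G" "z \<in> carrier G"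
  shows "comm x (comm y z) = \<one>"
  using assms comm_commute[of y z x] by (intro comm_unique) simp_all

section \<open>Collecting a variable\<close>

text \<open>All occurrences of \<open>x_i\<close> are brought to the front, one letter of the word
  at a time. Another letter that passes a power of \<open>x_i\<close> leaves a central commutator,
  and by bilinearity all of these merge into one commutator of \<open>x_i\<close> with a word
  \<open>u\<close> in the remaining variables, the same for all tuples.\<close>

lemma collect_variable:
  assumes "i \<in> J" "fst ` set w \<subseteq> J"
  obtains u where "fst ` set u \<subseteq> J - {i}"
    and "\<And>g. g \<in> J \<rightarrow> carrier G \<Longrightarrow> word_value G g w =
      g i [^] exponent_sum i w \<otimes> comm (g i) (word_value G g u)
        \<otimes> word_value G g (filter (\<lambda>a. fst a \<noteq> i) w)"
proof -
  have "\<exists>u. fst ` set u \<subseteq> J - {i} \<and> (\<forall>g\<in>J \<rightarrow> carrier G. word_value G g w =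
      g i [^] exponent_sum i w \<otimes> comm (g i) (word_value G g u)
        \<otimes> word_value G g (filter (\<lambda>a. fst a \<noteq> i) w))"
    using assms(2)
  proof (induction w)
    case Nil
    show ?case using assms(1) by (intro exI[of _ "[]"]) (auto simp: Pi_iff)
  next
    case (Cons a w)
    let ?n = "exponent_sum i w" and ?w = "filter (\<lambda>a. fst a \<noteq> i) w"
    obtain u where u: "fst ` set u \<subseteq> J - {i}"
      and eq: "\<And>g. g \<in> J \<rightarrow> carrier G \<Longrightarrow> word_value G g w =
         g i [^] ?n \<otimes> comm (g i) (word_value G g u) \<otimes> word_value G g ?w"
      using Cons by auto
    have a: "fst a \<in> J" and w: "fst ` set ?w \<subseteq> J" and uJ: "fst ` set u \<subseteq> J"
      using Cons.prems u by auto
    show ?case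
    proof (cases "fst a = i")
      case True
      have "word_value G g (a # w) =
          g i [^] exponent_sum i (a # w) \<otimes> comm (g i) (word_value G g u)
          \<otimes> word_value G g (filter (\<lambda>a. fst a \<noteq> i) (a # w))" if g: "g \<in> J \<rightarrow> carrier G" for g
      proof -
        have c: "g i \<in> carrier G" "word_value G g u \<in> carrier G" "word_value G g ?w \<in> carrier G"
          using g assms(1) word_value_closed[OF g] w uJ by auto
        then show ?thesis
          using True eq[OF g] letter_value_int_pow[of g a]
          by (simp add: int_pow_mult m_assoc del: int_pow_1)
      qed
      then show ?thesis using u by blast
    next
      case False
      \<comment> \<open>With \<open>n\<close> the exponent already collected,
        \<open>[a, x_i^n] = [x_i, a^(-n)]\<close> by bilinearity. So \<open>v\<close> has to
        evaluate to \<open>a^(-n)\<close>, and prepending it to \<open>u\<close> accounts for the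
        new commutator.\<close>
      obtain v where v: "fst ` set v \<subseteq> {fst a}"
        "\<And>g. g (fst a) \<in> carrier G \<Longrightarrow> word_value G g v = letter_value G g a [^] (- ?n)"
        using letter_power_word by blast
      have "word_value G g (a # w) =
          g i [^] exponent_sum i (a # w) \<otimes> comm (g i) (word_value G g (v @ u))
          \<otimes> word_value G g (filter (\<lambda>a. fst a \<noteq> i) (a # w))" if g: "g \<in> J \<rightarrow> carrier G" for g
      proof -
        let ?x = "g i" and ?y = "letter_value G g a" and ?u = "word_value G g u"
          and ?r = "word_value G g ?w"
        have c: "?x \<in> carrier G" "?y \<in> carrier G" "?u \<in> carrier G" "?r \<in> carrier G"
          "g (fst a) \<in> carrier G" "?x [^] ?n \<in> carrier G"
          using g assms(1) word_value_closed[OF g] letter_value_closed[OF g] a w uJ by auto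
        have "fst ` set v \<subseteq> J" using v(1) a by auto
        then have "comm ?x (word_value G g (v @ u)) = comm ?x (?y [^] (- ?n)) \<otimes> comm ?x ?u"
          using word_value_append[OF g _ uJ] v(2) c by (simp add: comm_mult_right)
        also have "comm ?x (?y [^] (- ?n)) = comm ?x ?y [^] (- ?n)"
          using c by (intro comm_int_pow_right)
        also have "\<dots> = inv (comm ?x ?y) [^] ?n"
          using c by (simp add: int_pow_neg int_pow_inv)
        also have "\<dots> = comm ?y (?x [^] ?n)"
          using c by (simp add: comm_inv comm_int_pow_right)
        finally have vu: "comm ?x (word_value G g (v @ u)) = comm ?y (?x [^] ?n) \<otimes> comm ?x ?u" .
        have "word_value G g (a # w) = (?y \<otimes> ?x [^] ?n) \<otimes> comm ?x ?u \<otimes> ?r"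
          using c eq[OF g] by (simp add: m_assoc)
        also have "?y \<otimes> ?x [^] ?n = ?x [^] ?n \<otimes> comm ?y (?x [^] ?n) \<otimes> ?y"
          using c mult_eq_comm_mult[of ?y "?x [^] ?n"] comm_commute[of ?y "?x [^] ?n" "?x [^] ?n"]
          by (simp flip: m_assoc)
        also have "\<dots> \<otimes> comm ?x ?u \<otimes> ?r =
            ?x [^] ?n \<otimes> comm ?y (?x [^] ?n) \<otimes> (?y \<otimes> comm ?x ?u) \<otimes> ?r"
          using c by (simp add: m_assoc)
        also have "\<dots> = ?x [^] ?n \<otimes> (comm ?y (?x [^] ?n) \<otimes> comm ?x ?u) \<otimes> (?y \<otimes> ?r)"
          using c comm_commute[of ?x ?u ?y] by (simp add: m_assoc)
        finally show ?thesis using False vu by simp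
      qed
      moreover have "fst ` set (v @ u) \<subseteq> J - {i}" using u v(1) a False by auto
      ultimately show ?thesis by blast
    qed
  qed
  then show thesis using that by blast
qed

text \<open>Such a word is a product of commutators, hence central. Collecting one variable leaves
  its zeroth power, a commutator, and a word in fewer variables whose exponent sums still
  vanish.\<close>

lemma comm_word_value_trivial:
  assumes "finite J" "fst ` set u \<subseteq> J" "\<forall>j\<in>J. exponent_sum j u = 0"
    and "g \<in> J \<rightarrow> carrier G" "x \<in> carrier G"
  shows "comm x (word_value G g u) = \<one>"
  using assms(1-4)
proof (induction J arbitrary: u)
  case empty
  then show ?case using assms(5) by simp
next
  case (insert i J)
  let ?u = "filter (\<lambda>a. fst a \<noteq> i) u"
  obtain v where v: "fst ` set v \<subseteq> insert i J - {i}"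
    "word_value G g u = g i [^] exponent_sum i u \<otimes> comm (g i) (word_value G g v) \<otimes> word_value G g ?u"
    using collect_variable[of i "insert i J" u] insert.prems by (metis insertI1)
  have u: "fst ` set ?u \<subseteq> J" using insert.prems by auto
  have g: "g \<in> J \<rightarrow> carrier G" "g i \<in> carrier G" using insert.prems by auto
  have c: "word_value G g v \<in> carrier G" "word_value G g ?u \<in> carrier G"
    using word_value_closed[OF g(1)] u v insert.hyps by auto
  have "comm x (word_value G g ?u) = \<one>"
    using insert.IH[OF u _ g(1)] insert.prems insert.hyps by (auto simp: exponent_sum_filter)
  then show ?case
    using v(2) c g insert.prems assms(5) by (simp add: comm_mult_right comm_comm_right)
qed

text \<open>Modulo central elements \<open>u\<close> is a power of \<open>x_m\<close>. Commutators
  with \<open>u\<close> therefore see only coordinate \<open>m\<close> of the tuple, whatever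
  happens to the other coordinates.\<close>

lemma comm_word_value_concentrated:
  assumes "finite J" "m \<in> J" "fst ` set u \<subseteq> J" "\<forall>j\<in>J - {m}. exponent_sum j u = 0"
    and g: "g \<in> J \<rightarrow> carrier G" and x: "x \<in> carrier G"
  shows "comm x (word_value G g u) = comm x (g m) [^] exponent_sum m u"
proof -
  let ?u = "filter (\<lambda>a. fst a \<noteq> m) u"
  obtain v where v: "fst ` set v \<subseteq> J - {m}"
    "word_value G g u = g m [^] exponent_sum m u \<otimes> comm (g m) (word_value G g v) \<otimes> word_value G g ?u"
    using collect_variable[OF assms(2,3)] g by metis
  have u: "fst ` set ?u \<subseteq> J" and vJ: "fst ` set v \<subseteq> J" using assms v by auto
  have c: "word_value G g v \<in> carrier G" "word_value G g ?u \<in> carrier G" "g m \<in> carrier G"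
    using word_value_closed[OF g] u vJ g assms(2) by auto
  have "comm x (word_value G g ?u) = \<one>"
    using comm_word_value_trivial[OF assms(1) u _ g x] assms(4) by (simp add: exponent_sum_filter)
  then show ?thesis
    using v(2) c x by (simp add: comm_mult_right comm_comm_right comm_int_pow_right)
qed

section \<open>Permutations of tuples that raise word values to a power\<close>

lemma comm_mult_int_pow:
  assumes "x \<in> carrier G" "y \<in> carrier G" "z \<in> carrier G"
  shows "(comm x y \<otimes> z) [^] (n :: int) = comm x y [^] n \<otimes> z [^] n"
  by (intro int_pow_mult_distrib comm_commute[symmetric] comm_closed assms)

text \<open>
  The exponents \<open>t\<close> and \<open>t'\<close> swap roles when passing from one variable to the next, which makes
  every other variable be raised to the power \<open>t\<close>.
\<close>

lemma alternating_power_bijection: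
  assumes "finite (carrier G)" "finite J"
    and "fst ` set u \<subseteq> J" "fst ` set w \<subseteq> J" "\<forall>j\<in>J. exponent_sum j w = 0"
    and "coprime t (int (order G))" "coprime t' (int (order G))"
  shows "\<exists>\<phi>. bij_betw \<phi> (J \<rightarrow>\<^sub>E carrier G) (J \<rightarrow>\<^sub>E carrier G)
    \<and> (\<forall>g\<in>J \<rightarrow>\<^sub>E carrier G.
         (\<forall>x\<in>carrier G. comm x (word_value G (\<phi> g) u) = comm x (word_value G g u) [^] t)
         \<and> word_value G (\<phi> g) w = word_value G g w [^] (t * t'))"
  using assms(2-7)
proof (induction "card J" arbitrary: J u w t t')
  case 0
  then have "J = {}" "u = []" "w = []" by auto
  then show ?case
    by (intro exI[of _ id]) simp
next
  case (Suc n)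
  let ?A = "J \<rightarrow>\<^sub>E carrier G"
  have "J \<noteq> {}" using Suc.hyps(2) by auto
  \<comment> \<open>The exponent sums of \<open>u\<close> are concentrated in \<open>m\<close>;
    those of \<open>w\<close> stay zero under the same substitution.\<close>
  obtain \<psi> s m where m: "m \<in> J" and \<psi>: "bij_betw \<psi> ?A ?A"
    and sJ: "\<And>w. fst ` set w \<subseteq> J \<Longrightarrow> fst ` set (s w) \<subseteq> J"
    and s: "\<And>w g. fst ` set w \<subseteq> J \<Longrightarrow> g \<in> ?A \<Longrightarrow> word_value G (\<psi> g) w = word_value G g (s w)"
    and s0: "\<And>w. \<forall>j\<in>J. exponent_sum j w = 0 \<Longrightarrow> \<forall>j\<in>J. exponent_sum j (s w) = 0"
    and su: "\<forall>j\<in>J - {m}. exponent_sum j (s u) = 0"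
    by (rule exponent_sum_concentrate[OF Suc.prems(1) \<open>J \<noteq> {}\<close> Suc.prems(2)]) blast
  note uJ = sJ[OF Suc.prems(2)] and wJ = sJ[OF Suc.prems(3)] and w0 = s0[OF Suc.prems(4)]
  let ?J = "J - {m}" and ?w = "filter (\<lambda>a. fst a \<noteq> m) (s w)"
  \<comment> \<open>As the exponent sum of \<open>x_m\<close> in \<open>s w\<close> is zero,
    \<open>s w\<close> evaluates to \<open>[x_m, v]\<close> times \<open>?w\<close>, where
    \<open>v\<close> and \<open>?w\<close> avoid \<open>x_m\<close>. This pair is treated by the
    induction hypothesis.\<close>
  obtain v where vJ: "fst ` set v \<subseteq> ?J" and v: "\<And>g. g \<in> J \<rightarrow> carrier G \<Longrightarrow> word_value G g (s w) =
      g m [^] exponent_sum m (s w) \<otimes> comm (g m) (word_value G g v) \<otimes> word_value G g ?w"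
    using collect_variable[OF m wJ] by blast
  have w'J: "fst ` set ?w \<subseteq> ?J" using wJ by auto
  have w'0: "\<forall>j\<in>?J. exponent_sum j ?w = 0" using w0 by (simp add: exponent_sum_filter)
  have J': "n = card ?J" "finite ?J" using Suc.hyps(2) Suc.prems(1) m by auto
  \<comment> \<open>Exponents exchanged: in \<open>[x_m, v]\<close> the variable \<open>x_m\<close>
    will contribute \<open>t\<close> and \<open>v\<close> contributes \<open>t'\<close>, which
    matches the power \<open>t' * t\<close> of \<open>?w\<close>.\<close>
  obtain \<phi>' where \<phi>': "bij_betw \<phi>' (?J \<rightarrow>\<^sub>E carrier G) (?J \<rightarrow>\<^sub>E carrier G)"
    and \<phi>'v: "\<And>g x. g \<in> ?J \<rightarrow>\<^sub>E carrier G \<Longrightarrow> x \<in> carrier G \<Longrightarrow>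
      comm x (word_value G (\<phi>' g) v) = comm x (word_value G g v) [^] t'"
    and \<phi>'w: "\<And>g. g \<in> ?J \<rightarrow>\<^sub>E carrier G \<Longrightarrow>
      word_value G (\<phi>' g) ?w = word_value G g ?w [^] (t' * t)"
    using Suc.hyps(1)[OF J' vJ w'J w'0 Suc.prems(6,5)] by blast
  define \<phi>0 where "\<phi>0 g = (\<phi>' (restrict g ?J))(m := g m [^] t)" for g
  have \<phi>0: "bij_betw \<phi>0 ?A ?A"
    using bij_betw_extend_tuple[OF assms(1) Suc.prems(1) m Suc.prems(5) \<phi>'] by (simp add: \<phi>0_def[abs_def])
  \<comment> \<open>Only coordinate \<open>m\<close> matters here, and \<open>\<phi>0\<close> raises
    it to the power \<open>t\<close>.\<close>
  have \<phi>0u: "comm x (word_value G (\<phi>0 g) (s u)) = comm x (word_value G g (s u)) [^] t"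
    if g: "g \<in> ?A" and x: "x \<in> carrier G" for g x
  proof -
    have gp: "g \<in> J \<rightarrow> carrier G" "\<phi>0 g \<in> J \<rightarrow> carrier G" "g m \<in> carrier G"
      using g m bij_betwE[OF \<phi>0] by auto
    show ?thesis
      using comm_word_value_concentrated[OF Suc.prems(1) m uJ su _ x] gp x
      by (simp add: \<phi>0_def comm_int_pow_right int_pow_pow mult.commute)
  qed
  have \<phi>0w: "word_value G (\<phi>0 g) (s w) = word_value G g (s w) [^] (t * t')" if g: "g \<in> ?A" for g
  proof -
    have gp: "g \<in> J \<rightarrow> carrier G" "\<phi>0 g \<in> J \<rightarrow> carrier G" "g m \<in> carrier G"
      using g m bij_betwE[OF \<phi>0] by auto
    let ?g = "restrict g ?J"
    have r: "?g \<in> ?J \<rightarrow>\<^sub>E carrier G" using g by auto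
    have c: "word_value G g v \<in> carrier G" "word_value G g ?w \<in> carrier G"
      "word_value G (\<phi>0 g) v \<in> carrier G" "word_value G (\<phi>0 g) ?w \<in> carrier G"
      using word_value_closed[OF gp(1)] word_value_closed[OF gp(2)] vJ w'J by blast+
    have cong: "word_value G (\<phi>0 g) z = word_value G (\<phi>' ?g) z"
      "word_value G ?g z = word_value G g z" if "fst ` set z \<subseteq> ?J" for z
    proof -
      have "i \<in> ?J" if "i \<in> fst ` set z" for i
        using \<open>fst ` set z \<subseteq> ?J\<close> that by blast
      then show "word_value G (\<phi>0 g) z = word_value G (\<phi>' ?g) z"
        "word_value G ?g z = word_value G g z"
        by (intro word_value_cong, simp add: \<phi>0_def)+
    qed
    have "word_value G (\<phi>0 g) (s w)
        = comm (g m [^] t) (word_value G (\<phi>0 g) v) \<otimes> word_value G (\<phi>0 g) ?w"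
      using v[OF gp(2)] w0 m c gp by (simp add: \<phi>0_def)
    also have "comm (g m [^] t) (word_value G (\<phi>0 g) v) = comm (g m) (word_value G g v) [^] (t * t')"
      using \<phi>'v[OF r, of "g m [^] t"] c gp cong[OF vJ] by (simp add: comm_int_pow_left int_pow_pow)
    also have "word_value G (\<phi>0 g) ?w = word_value G g ?w [^] (t * t')"
      using \<phi>'w[OF r] cong[OF w'J] by (simp add: mult.commute)
    also have "comm (g m) (word_value G g v) [^] (t * t') \<otimes> \<dots>
        = (comm (g m) (word_value G g v) \<otimes> word_value G g ?w) [^] (t * t')"
      using c gp by (simp add: comm_mult_int_pow)
    also have "comm (g m) (word_value G g v) \<otimes> word_value G g ?w = word_value G g (s w)"
      using v[OF gp(1)] w0 m c gp by simp
    finally show ?thesis .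
  qed
  \<comment> \<open>\<open>\<phi>0\<close> was built for the substituted words; conjugation by
    \<open>\<psi>\<close> carries it back to the original ones.\<close>
  let ?\<phi> = "\<psi> \<circ> (\<phi>0 \<circ> inv_into ?A \<psi>)"
  have "bij_betw ?\<phi> ?A ?A"
    using bij_betw_inv_into[OF \<psi>] \<phi>0 \<psi> by (blast intro: bij_betw_trans)
  moreover have "(\<forall>x\<in>carrier G. comm x (word_value G (?\<phi> g) u) = comm x (word_value G g u) [^] t)
         \<and> word_value G (?\<phi> g) w = word_value G g w [^] (t * t')" if g: "g \<in> ?A" for g
  proof -
    define h where "h = inv_into ?A \<psi> g"
    have h: "h \<in> ?A" "\<psi> h = g"
      using bij_betwE[OF bij_betw_inv_into[OF \<psi>]] bij_betw_inv_into_right[OF \<psi>] g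
      unfolding h_def by blast+
    have "\<phi>0 h \<in> ?A" using h(1) bij_betwE[OF \<phi>0] by blast
    then have "word_value G (?\<phi> g) z = word_value G (\<phi>0 h) (s z)"
      "word_value G g z = word_value G h (s z)" if "fst ` set z \<subseteq> J" for z
      using s[OF that] h by (auto simp flip: h_def)
    then show ?thesis using \<phi>0u \<phi>0w h(1) Suc.prems(2,3) by simp
  qed
  ultimately show ?case by blast
qed

text \<open>Now the exponent sums of \<open>w\<close> itself are concentrated in one variable, so
  that \<open>w\<close> becomes \<open>x_m^d [x_m, v]\<close> times a word with vanishing sums.
  Raising \<open>x_m\<close> to the power \<open>e\<close> serves the first two factors, provided
  that the other coordinates are permuted without changing commutators with
  \<open>v\<close>.\<close>

lemma word_value_power_bijection:
  assumes fin: "finite (carrier G)" and J: "finite J" "fst ` set w \<subseteq> J"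
    and e: "coprime e (int (order G))"
  shows "\<exists>\<phi>. bij_betw \<phi> (J \<rightarrow>\<^sub>E carrier G) (J \<rightarrow>\<^sub>E carrier G)
    \<and> (\<forall>g\<in>J \<rightarrow>\<^sub>E carrier G. word_value G (\<phi> g) w = word_value G g w [^] e)"
proof (cases "J = {}")
  case True
  with J show ?thesis by (intro exI[of _ id]) auto
next
  case False
  let ?A = "J \<rightarrow>\<^sub>E carrier G"
  obtain \<psi> s m where m: "m \<in> J" and \<psi>: "bij_betw \<psi> ?A ?A"
    and sJ: "\<And>w. fst ` set w \<subseteq> J \<Longrightarrow> fst ` set (s w) \<subseteq> J"
    and s: "\<And>w g. fst ` set w \<subseteq> J \<Longrightarrow> g \<in> ?A \<Longrightarrow> word_value G (\<psi> g) w = word_value G g (s w)"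
    and sw: "\<forall>j\<in>J - {m}. exponent_sum j (s w) = 0"
    by (rule exponent_sum_concentrate[OF J(1) False J(2)]) blast
  note wJ = sJ[OF J(2)]
  let ?J = "J - {m}" and ?w = "filter (\<lambda>a. fst a \<noteq> m) (s w)" and ?d = "exponent_sum m (s w)"
  obtain v where vJ: "fst ` set v \<subseteq> ?J" and v: "\<And>g. g \<in> J \<rightarrow> carrier G \<Longrightarrow> word_value G g (s w) =
      g m [^] ?d \<otimes> comm (g m) (word_value G g v) \<otimes> word_value G g ?w"
    using collect_variable[OF m wJ] by blast
  have w'J: "fst ` set ?w \<subseteq> ?J" using wJ by auto
  have w'0: "\<forall>j\<in>?J. exponent_sum j ?w = 0" using sw by (simp add: exponent_sum_filter)
  \<comment> \<open>The exponents \<open>1\<close> and \<open>e\<close> keep commutators with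
    \<open>v\<close> fixed while \<open>?w\<close> is raised to the power \<open>e\<close>.\<close>
  obtain \<phi>' where \<phi>': "bij_betw \<phi>' (?J \<rightarrow>\<^sub>E carrier G) (?J \<rightarrow>\<^sub>E carrier G)"
    and \<phi>'v: "\<And>g x. g \<in> ?J \<rightarrow>\<^sub>E carrier G \<Longrightarrow> x \<in> carrier G \<Longrightarrow>
      comm x (word_value G (\<phi>' g) v) = comm x (word_value G g v) [^] (1 :: int)"
    and \<phi>'w: "\<And>g. g \<in> ?J \<rightarrow>\<^sub>E carrier G \<Longrightarrow>
      word_value G (\<phi>' g) ?w = word_value G g ?w [^] (1 * e)"
    using alternating_power_bijection[OF fin _ vJ w'J w'0 _ e, of 1] J(1)
    by (metis coprime_1_left finite_Diff)
  define \<phi>0 where "\<phi>0 g = (\<phi>' (restrict g ?J))(m := g m [^] e)" for g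
  have \<phi>0: "bij_betw \<phi>0 ?A ?A"
    using bij_betw_extend_tuple[OF fin J(1) m e \<phi>'] by (simp add: \<phi>0_def[abs_def])
  have \<phi>0w: "word_value G (\<phi>0 g) (s w) = word_value G g (s w) [^] e" if g: "g \<in> ?A" for g
  proof -
    have gp: "g \<in> J \<rightarrow> carrier G" "\<phi>0 g \<in> J \<rightarrow> carrier G" "g m \<in> carrier G"
      using g m bij_betwE[OF \<phi>0] by auto
    let ?g = "restrict g ?J"
    have r: "?g \<in> ?J \<rightarrow>\<^sub>E carrier G" using g by auto
    have c: "word_value G g v \<in> carrier G" "word_value G g ?w \<in> carrier G"
      "word_value G (\<phi>0 g) v \<in> carrier G" "word_value G (\<phi>0 g) ?w \<in> carrier G"
      using word_value_closed[OF gp(1)] word_value_closed[OF gp(2)] vJ w'J by blast+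
    have cong: "word_value G (\<phi>0 g) z = word_value G (\<phi>' ?g) z"
      "word_value G ?g z = word_value G g z" if "fst ` set z \<subseteq> ?J" for z
    proof -
      have "i \<in> ?J" if "i \<in> fst ` set z" for i
        using \<open>fst ` set z \<subseteq> ?J\<close> that by blast
      then show "word_value G (\<phi>0 g) z = word_value G (\<phi>' ?g) z"
        "word_value G ?g z = word_value G g z"
        by (intro word_value_cong, simp add: \<phi>0_def)+
    qed
    \<comment> \<open>Vanishing exponent sums make \<open>?w\<close> central, so that the power
      \<open>e\<close> distributes over the whole product below.\<close>
    have central: "word_value G g ?w \<otimes> x = x \<otimes> word_value G g ?w" if x: "x \<in> carrier G" for x
    proof -
      have "comm x (word_value G g ?w) = \<one>"
        using comm_word_value_trivial[of ?J ?w g x] J(1) w'J w'0 gp x by auto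
      then show ?thesis using mult_eq_comm_mult[OF x c(2)] x c by simp
    qed
    have "word_value G (\<phi>0 g) (s w) = (g m [^] e) [^] ?d
        \<otimes> comm (g m [^] e) (word_value G (\<phi>0 g) v) \<otimes> word_value G (\<phi>0 g) ?w"
      using v[OF gp(2)] by (simp add: \<phi>0_def)
    also have "(g m [^] e) [^] ?d = (g m [^] ?d) [^] e"
      using gp by (simp add: int_pow_pow mult.commute)
    also have "comm (g m [^] e) (word_value G (\<phi>0 g) v) = comm (g m) (word_value G g v) [^] e"
      using \<phi>'v[OF r, of "g m [^] e"] c gp cong[OF vJ] by (simp add: comm_int_pow_left)
    also have "(g m [^] ?d) [^] e \<otimes> comm (g m) (word_value G g v) [^] e
        = (g m [^] ?d \<otimes> comm (g m) (word_value G g v)) [^] e"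
      by (intro int_pow_mult_distrib[symmetric] comm_commute) (use c gp in simp_all)
    also have "word_value G (\<phi>0 g) ?w = word_value G g ?w [^] e"
      using \<phi>'w[OF r] cong[OF w'J] by simp
    also have "(g m [^] ?d \<otimes> comm (g m) (word_value G g v)) [^] e \<otimes> word_value G g ?w [^] e
        = word_value G g (s w) [^] e"
      using c gp central v[OF gp(1)] by (simp add: int_pow_mult_distrib)
    finally show ?thesis .
  qed
  let ?\<phi> = "\<psi> \<circ> (\<phi>0 \<circ> inv_into ?A \<psi>)"
  have "bij_betw ?\<phi> ?A ?A"
    using bij_betw_inv_into[OF \<psi>] \<phi>0 \<psi> by (blast intro: bij_betw_trans)
  moreover have "word_value G (?\<phi> g) w = word_value G g w [^] e" if g: "g \<in> ?A" for g
  proof -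
    define h where "h = inv_into ?A \<psi> g"
    have h: "h \<in> ?A" "\<psi> h = g"
      using bij_betwE[OF bij_betw_inv_into[OF \<psi>]] bij_betw_inv_into_right[OF \<psi>] g
      unfolding h_def by blast+
    have "\<phi>0 h \<in> ?A" using h(1) bij_betwE[OF \<phi>0] by blast
    then show ?thesis using s[OF J(2)] h \<phi>0w[OF h(1)] by (auto simp flip: h_def)
  qed
  ultimately show ?thesis by blast
qed

section \<open>Counting solutions and nilpotency class 2\<close>

text \<open>The permutation of tuples that raises word values to the power \<open>e\<close>
  restricts to a bijection from the solutions of \<open>w = x\<close> onto those of
  \<open>w = x^e\<close>.\<close>

lemma rational_group_if_finite:
  assumes fin: "finite (carrier G)"
  shows "rational_group G"
  unfolding rational_group_def rational_pair_def
proof (intro allI ballI impI)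
  fix k w x and e :: int
  assume w: "w \<in> carrier (free_group {1..k :: nat})" and x: "x \<in> carrier G"
    and e: "coprime e (int (order G))"
  let ?A = "{1..k} \<rightarrow>\<^sub>E carrier G"
  have wk: "fst ` set w \<subseteq> {1..k}" using w by (simp add: free_group_def)
  obtain \<phi> where \<phi>: "bij_betw \<phi> ?A ?A"
    and \<phi>w: "\<And>g. g \<in> ?A \<Longrightarrow> word_value G (\<phi> g) w = word_value G g w [^] e"
    using word_value_power_bijection[OF fin _ wk e] by auto
  have count: "word_count G k w y = card {g \<in> ?A. word_value G g w = y}" for y
  proof -
    have "free_hom G {1..k} g w = word_value G g w" if "g \<in> ?A" for g
      using that w by (subst free_hom_eq) auto
    then show ?thesis unfolding word_count_def by (metis (no_types, lifting))
  qed
  \<comment> \<open>The direction from left to right is where injectivity of the power map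
    enters.\<close>
  have iff: "word_value G (\<phi> g) w = x [^] e \<longleftrightarrow> word_value G g w = x" if g: "g \<in> ?A" for g
  proof -
    have "word_value G g w \<in> carrier G" using word_value_closed[OF _ wk] g by auto
    then show ?thesis
      using \<phi>w[OF g] inj_on_int_pow[OF fin e] x by (auto dest: inj_onD)
  qed
  have "\<phi> ` {g \<in> ?A. word_value G g w = x} = {g \<in> ?A. word_value G g w = x [^] e}"
  proof (intro equalityI subsetI)
    fix g assume g: "g \<in> {g \<in> ?A. word_value G g w = x [^] e}"
    then have "g \<in> \<phi> ` ?A" using \<phi> by (simp add: bij_betw_def)
    then obtain h where "h \<in> ?A" "g = \<phi> h" by blast
    then show "g \<in> \<phi> ` {g \<in> ?A. word_value G g w = x}" using g iff by auto
  qed (use iff bij_betwE[OF \<phi>] in auto)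
  moreover have "inj_on \<phi> {g \<in> ?A. word_value G g w = x}"
    using \<phi> unfolding bij_betw_def by (metis (no_types, lifting) inj_on_subset mem_Collect_eq subsetI)
  ultimately show "word_count G k w x = word_count G k w (x [^] e)"
    unfolding count using card_image by fastforce
qed

end

theorem corollary4p3:
  fixes G :: "('a, 'b) monoid_scheme"
  assumes "group G" and "finite (carrier G)"
    and "nilpotent G" and "nilpotency_class G = 2"
  shows "rational_group G"
proof -
  interpret group G by fact
  have "lower_central G (nilpotency_class G) = {\<one>\<^bsub>G\<^esub>}"
    using assms(3) unfolding nilpotent_def nilpotency_class_def by (rule LeastI_ex)
  \<comment> \<open>The series is indexed from \<open>0\<close>, so class 2 makes the term of index
    2 trivial, that is, the commutators of the derived subgroup with the whole group.\<close>
  then have lc: "lower_central G (Suc (Suc 0)) = {\<one>\<^bsub>G\<^esub>}"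
    using assms(4) by (simp add: numeral_2_eq_2)
  have "(x \<otimes>\<^bsub>G\<^esub> y \<otimes>\<^bsub>G\<^esub> inv\<^bsub>G\<^esub> x \<otimes>\<^bsub>G\<^esub> inv\<^bsub>G\<^esub> y) \<otimes>\<^bsub>G\<^esub> z
      = z \<otimes>\<^bsub>G\<^esub> (x \<otimes>\<^bsub>G\<^esub> y \<otimes>\<^bsub>G\<^esub> inv\<^bsub>G\<^esub> x \<otimes>\<^bsub>G\<^esub> inv\<^bsub>G\<^esub> y)"
    if xyz: "x \<in> carrier G" "y \<in> carrier G" "z \<in> carrier G" for x y z
  proof -
    define c where "c = x \<otimes>\<^bsub>G\<^esub> y \<otimes>\<^bsub>G\<^esub> inv\<^bsub>G\<^esub> x \<otimes>\<^bsub>G\<^esub> inv\<^bsub>G\<^esub> y"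
    have c: "c \<in> carrier G" using xyz by (simp add: c_def)
    \<comment> \<open>\<open>c\<close> is a generator of the term of index 1, so its commutator with
      \<open>z\<close> is a generator of the trivial term of index 2.\<close>
    have "c \<in> lower_central G (Suc 0)"
      unfolding lower_central.simps c_def by (rule generate.incl) (use xyz in blast)
    then have "c \<otimes>\<^bsub>G\<^esub> z \<otimes>\<^bsub>G\<^esub> inv\<^bsub>G\<^esub> c \<otimes>\<^bsub>G\<^esub> inv\<^bsub>G\<^esub> z \<in> lower_central G (Suc (Suc 0))"
      unfolding lower_central.simps(2)[of G "Suc 0"] by (intro generate.incl) (use xyz in blast)
    then have "(c \<otimes>\<^bsub>G\<^esub> z) \<otimes>\<^bsub>G\<^esub> inv\<^bsub>G\<^esub> (z \<otimes>\<^bsub>G\<^esub> c) = \<one>\<^bsub>G\<^esub>"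
      using lc c xyz by (simp add: inv_mult_group m_assoc)
    then have "c \<otimes>\<^bsub>G\<^esub> z = z \<otimes>\<^bsub>G\<^esub> c"
      using c xyz by (metis inv_closed inv_equality inv_inv m_closed)
    then show ?thesis by (simp add: c_def)
  qed
  then interpret central_comm_group G by unfold_locales
  show ?thesis by (rule rational_group_if_finite) fact
qed

end
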